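(* Let $G$ be a finite group. If $\psi$ is a fixed-point-free abelian endomorphism of $G$ and $N$ is a regular $G$-stable subgroup of $\mathrm{Perm}(G)$ that is brace equivalent to $N_\psi$, then $N$ is $G$-isomorphic to $\lambda(G)$.
   Context: An endomorphism $\psi:G\to G$ is abelian if $\psi(\sigma\tau)=\psi(\tau\sigma)$ for all $\sigma,\tau\in G$, and fixed-point-free if $\psi(\sigma)=\sigma$ only when $\sigma=1_G$. $\mathrm{Perm}(G)$ is the group of permutations of $G$, $\lambda:G\to\mathrm{Perm}(G)$ is the left regular representation $\lambda(\sigma)[\tau]=\sigma\tau$, and $C(\sigma)$ is the inner automorphism $\tau\mapsto\sigma\tau\sigma^{-1}$. $G$ acts on $\mathrm{Perm}(G)$ by ${}^{\sigma}\pi=\lambda(\sigma)\pi\lambda(\sigma)^{-1}$. A subgroup $N\le\mathrm{Perm}(G)$ is regular if it acts transitively on $G$ with trivial stabilizers, and $G$-stable if ${}^{\sigma}\eta\in N$ for all $\sigma\in G$, $\eta\in N$. Two regular $G$-stable subgroups $N,M$ are $G$-isomorphic if there is a group isomorphism $\theta:N\to M$ with $\theta({}^{\sigma}\eta)={}^{\sigma}\theta(\eta)$ for all $\eta\in N$, $\sigma\in G$. For an abelian endomorphism $\psi$ let $N_\psi=\{\lambda(\sigma)C(\psi(\sigma^{-1}))\mid\sigma\in G\}$ (so the element attached to $\sigma$ is $\tau\mapsto\sigma\psi(\sigma^{-1})\tau\psi(\sigma)$), which is known to be a regular $G$-stable subgroup of $\mathrm{Perm}(G)$. A brace (skew left brace)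 is a triple $(B,\cdot,\circ)$ where $(B,\cdot)$ and $(B,\circ)$ are finite groups with $x\circ(y\cdot z)=(x\circ y)\cdot x^{-1}\cdot(x\circ z)$ for all $x,y,z\in B$ ($x^{-1}$ being the inverse in $(B,\cdot)$); an isomorphism of braces is a bijection respecting both operations. For a regular $G$-stable subgroup $N$, the map $a:N\to G$, $a(\eta)=\eta[1_G]$, is a bijection, and $\mathfrak{B}_N=(N,\cdot,\circ)$, with $\cdot$ the composition in $N$ and $\eta\circ\pi=a^{-1}(a(\eta)a(\pi))$, is a brace. Two regular $G$-stable subgroups $N,M$ of $\mathrm{Perm}(G)$ are brace equivalent if $\mathfrak{B}_N\cong\mathfrak{B}_M$ as braces. *)

theory Defs
  imports "HOL-Algebra.Bij"
begin

section \<open>Endomorphisms\<close>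

definition abelian_endomorphism :: "('a, 'b) monoid_scheme \<Rightarrow> ('a \<Rightarrow> 'a) \<Rightarrow> bool" where
  "abelian_endomorphism G \<psi> \<longleftrightarrow>
     \<psi> \<in> hom G G \<and>
     (\<forall>\<sigma>\<in>carrier G. \<forall>\<tau>\<in>carrier G. \<psi> (\<sigma> \<otimes>\<^bsub>G\<^esub> \<tau>) = \<psi> (\<tau> \<otimes>\<^bsub>G\<^esub> \<sigma>))"

definition fixed_point_free :: "('a, 'b) monoid_scheme \<Rightarrow> ('a \<Rightarrow> 'a) \<Rightarrow> bool" where
  "fixed_point_free G \<psi> \<longleftrightarrow> (\<forall>\<sigma>\<in>carrier G. \<psi> \<sigma> = \<sigma> \<longrightarrow> \<sigma> = \<one>\<^bsub>G\<^esub>)"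


section \<open>Regular \<open>G\<close>-stable subgroups\<close>

text \<open>
  Permutations of \<open>carrier G\<close> are extensional functions, as in \<^const>\<open>BijGroup\<close>; hence the
  restricted abstractions below.
\<close>

abbreviation Perm :: "('a, 'b) monoid_scheme \<Rightarrow> ('a \<Rightarrow> 'a) monoid" where
  "Perm G \<equiv> BijGroup (carrier G)"

definition left_reg :: "('a, 'b) monoid_scheme \<Rightarrow> 'a \<Rightarrow> 'a \<Rightarrow> 'a" where
  "left_reg G \<sigma> = (\<lambda>\<tau>\<in>carrier G. \<sigma> \<otimes>\<^bsub>G\<^esub> \<tau>)"

definition inner_aut :: "('a, 'b) monoid_scheme \<Rightarrow> 'a \<Rightarrow> 'a \<Rightarrow> 'a" where
  "inner_aut G \<sigma> = (\<lambda>\<tau>\<in>carrier G. \<sigma> \<otimes>\<^bsub>G\<^esub> \<tau> \<otimes>\<^bsub>G\<^esub> inv\<^bsub>G\<^esub> \<sigma>)"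

definition perm_act :: "('a, 'b) monoid_scheme \<Rightarrow> 'a \<Rightarrow> ('a \<Rightarrow> 'a) \<Rightarrow> 'a \<Rightarrow> 'a" where
  "perm_act G \<sigma> \<pi> =
     left_reg G \<sigma> \<otimes>\<^bsub>Perm G\<^esub> \<pi> \<otimes>\<^bsub>Perm G\<^esub> inv\<^bsub>Perm G\<^esub> (left_reg G \<sigma>)"

definition regular_subgroup :: "('a, 'b) monoid_scheme \<Rightarrow> ('a \<Rightarrow> 'a) set \<Rightarrow> bool" where
  "regular_subgroup G N \<longleftrightarrow>
     subgroup N (Perm G) \<and>
     (\<forall>x\<in>carrier G. \<forall>y\<in>carrier G. \<exists>\<eta>\<in>N. \<eta> x = y) \<and>
     (\<forall>x\<in>carrier G. \<forall>\<eta>\<in>N. \<eta> x = x \<longrightarrow> \<eta> = \<one>\<^bsub>Perm G\<^esub>)"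

definition G_stable :: "('a, 'b) monoid_scheme \<Rightarrow> ('a \<Rightarrow> 'a) set \<Rightarrow> bool" where
  "G_stable G N \<longleftrightarrow> (\<forall>\<sigma>\<in>carrier G. \<forall>\<eta>\<in>N. perm_act G \<sigma> \<eta> \<in> N)"

definition G_isomorphic ::
  "('a, 'b) monoid_scheme \<Rightarrow> ('a \<Rightarrow> 'a) set \<Rightarrow> ('a \<Rightarrow> 'a) set \<Rightarrow> bool" where
  "G_isomorphic G N M \<longleftrightarrow>
     (\<exists>\<theta>\<in>iso ((Perm G)\<lparr>carrier := N\<rparr>) ((Perm G)\<lparr>carrier := M\<rparr>).
        \<forall>\<eta>\<in>N. \<forall>\<sigma>\<in>carrier G. \<theta> (perm_act G \<sigma> \<eta>) = perm_act G \<sigma> (\<theta> \<eta>))"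

definition N_of :: "('a, 'b) monoid_scheme \<Rightarrow> ('a \<Rightarrow> 'a) \<Rightarrow> ('a \<Rightarrow> 'a) set" where
  "N_of G \<psi> =
     {left_reg G \<sigma> \<otimes>\<^bsub>Perm G\<^esub> inner_aut G (\<psi> (inv\<^bsub>G\<^esub> \<sigma>)) | \<sigma>. \<sigma> \<in> carrier G}"


section \<open>Skew left braces\<close>

record 'a brace = "'a monoid" +
  circ :: "'a \<Rightarrow> 'a \<Rightarrow> 'a"

text \<open>
  The inherited \<^const>\<open>mult\<close> and \<^const>\<open>one\<close> belong to the dot group; the identity of the circle
  group is existentially quantified.
\<close>

definition skew_brace :: "('a, 'b) brace_scheme \<Rightarrow> bool" where
  "skew_brace B \<longleftrightarrow>
     finite (carrier B) \<and> group B \<and>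
     (\<exists>e. group \<lparr>carrier = carrier B, mult = circ B, one = e\<rparr>) \<and>
     (\<forall>x\<in>carrier B. \<forall>y\<in>carrier B. \<forall>z\<in>carrier B.
        circ B x (y \<otimes>\<^bsub>B\<^esub> z) = circ B x y \<otimes>\<^bsub>B\<^esub> inv\<^bsub>B\<^esub> x \<otimes>\<^bsub>B\<^esub> circ B x z)"

definition brace_isomorphic :: "('a, 'b) brace_scheme \<Rightarrow> ('c, 'd) brace_scheme \<Rightarrow> bool" where
  "brace_isomorphic A B \<longleftrightarrow>
     (\<exists>f. bij_betw f (carrier A) (carrier B) \<and>
        (\<forall>x\<in>carrier A. \<forall>y\<in>carrier A.
           f (x \<otimes>\<^bsub>A\<^esub> y) = f x \<otimes>\<^bsub>B\<^esub> f y \<and> f (circ A x y) = circ B (f x) (f y)))"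

definition ev_one :: "('a, 'b) monoid_scheme \<Rightarrow> ('a \<Rightarrow> 'a) \<Rightarrow> 'a" where
  "ev_one G \<eta> = \<eta> \<one>\<^bsub>G\<^esub>"

definition brace_of :: "('a, 'b) monoid_scheme \<Rightarrow> ('a \<Rightarrow> 'a) set \<Rightarrow> ('a \<Rightarrow> 'a) brace" where
  "brace_of G N =
     \<lparr>carrier = N, mult = mult (Perm G), one = one (Perm G),
      circ = (\<lambda>\<eta> \<pi>. inv_into N (ev_one G) (ev_one G \<eta> \<otimes>\<^bsub>G\<^esub> ev_one G \<pi>))\<rparr>"

definition brace_equivalent ::
  "('a, 'b) monoid_scheme \<Rightarrow> ('a \<Rightarrow> 'a) set \<Rightarrow> ('a \<Rightarrow> 'a) set \<Rightarrow> bool" where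
  "brace_equivalent G N M \<longleftrightarrow> brace_isomorphic (brace_of G N) (brace_of G M)"


section \<open>Well-definedness\<close>

text \<open>
  For regular \<open>G\<close>-stable \<open>N\<close> the evaluation map is a bijection and \<^const>\<open>brace_of\<close> is a brace;
  for abelian \<open>\<psi>\<close> the set \<^const>\<open>N_of\<close> is a regular \<open>G\<close>-stable subgroup.
\<close>

lemma (in group) left_reg_in_Bij:
  assumes "s \<in> carrier G"
  shows "left_reg G s \<in> Bij (carrier G)"
proof -
  have "bij_betw (left_reg G s) (carrier G) (carrier G)"
    unfolding left_reg_def
    by (rule bij_betwI[where g = "\<lambda>t. inv s \<otimes> t"])
       (use assms in \<open>auto simp: m_assoc[symmetric]\<close>)
  then show ?thesis by (simp add: Bij_def left_reg_def)
qed

lemma (in group) inner_aut_in_Bij: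
  assumes "s \<in> carrier G"
  shows "inner_aut G s \<in> Bij (carrier G)"
proof -
  have "bij_betw (inner_aut G s) (carrier G) (carrier G)"
    unfolding inner_aut_def
    by (rule bij_betwI[where g = "\<lambda>t. inv s \<otimes> t \<otimes> s"])
       (use assms in \<open>auto simp: m_assoc simp flip: m_assoc[of s "inv s"] m_assoc[of "inv s" s]\<close>)
  then show ?thesis by (simp add: Bij_def inner_aut_def)
qed

lemma Perm_apply:
  assumes "f \<in> Bij S" "g \<in> Bij S" "x \<in> S"
  shows "(f \<otimes>\<^bsub>BijGroup S\<^esub> g) x = f (g x)"
  using assms by (simp add: BijGroup_def compose_def)

lemma (in group) perm_act_left_reg:
  assumes "s \<in> carrier G" "p \<in> Bij (carrier G)" "x \<in> carrier G"
  shows "perm_act G s p x = s \<otimes> p (inv s \<otimes> x)"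
proof -
  interpret P: group "Perm G" by (rule group_BijGroup)
  have carr: "carrier (Perm G) = Bij (carrier G)" by (simp add: BijGroup_def)
  have ls: "left_reg G s \<in> Bij (carrier G)" by (rule left_reg_in_Bij[OF assms(1)])
  have li: "left_reg G (inv s) \<in> Bij (carrier G)" using assms by (simp add: left_reg_in_Bij)
  have "left_reg G s \<otimes>\<^bsub>Perm G\<^esub> left_reg G (inv s) = \<one>\<^bsub>Perm G\<^esub>"
    using ls li assms
    by (auto simp: BijGroup_def compose_def left_reg_def m_assoc[symmetric] fun_eq_iff)
  then have inv_eq: "inv\<^bsub>Perm G\<^esub> (left_reg G s) = left_reg G (inv s)"
    using ls li carr by (metis P.inv_equality P.inv_inv)
  have px: "p (inv s \<otimes> x) \<in> carrier G"
    using assms Bij_imp_funcset[OF assms(2)] by auto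
  have sp: "left_reg G s \<otimes>\<^bsub>Perm G\<^esub> p \<in> Bij (carrier G)"
    using P.m_closed ls assms(2) carr by metis
  have "left_reg G (inv s) x = inv s \<otimes> x" using assms by (simp add: left_reg_def)
  then show ?thesis
    using assms px by (simp add: perm_act_def inv_eq Perm_apply ls li sp) (simp add: left_reg_def)
qed

lemma (in group) perm_act_closed:
  assumes "s \<in> carrier G" "p \<in> Bij (carrier G)"
  shows "perm_act G s p \<in> Bij (carrier G)"
proof -
  interpret P: group "Perm G" by (rule group_BijGroup)
  have carr: "carrier (Perm G) = Bij (carrier G)" by (simp add: BijGroup_def)
  show ?thesis
    using left_reg_in_Bij[OF assms(1)] assms(2) carr P.m_closed P.inv_closed
    by (metis perm_act_def)
qed

lemma (in group) ev_one_bij_betw: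
  assumes "regular_subgroup G N"
  shows "bij_betw (ev_one G) N (carrier G)"
proof -
  interpret P: group "Perm G" by (rule group_BijGroup)
  have carr: "carrier (Perm G) = Bij (carrier G)" by (simp add: BijGroup_def)
  have N: "subgroup N (Perm G)" using assms by (simp add: regular_subgroup_def)
  have sub: "N \<subseteq> Bij (carrier G)" using subgroup.subset[OF N] carr by simp
  have "inj_on (ev_one G) N"
  proof (rule inj_onI)
    fix f g assume fg: "f \<in> N" "g \<in> N" "ev_one G f = ev_one G g"
    let ?h = "inv\<^bsub>Perm G\<^esub> g \<otimes>\<^bsub>Perm G\<^esub> f"
    have hN: "?h \<in> N" using N fg by (simp add: subgroup.m_closed subgroup.m_inv_closed)
    have gi: "inv\<^bsub>Perm G\<^esub> g \<in> Bij (carrier G)"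
      using fg sub carr by (metis P.inv_closed subsetD)
    have "?h \<one> = (inv\<^bsub>Perm G\<^esub> g) (g \<one>)"
      using fg sub gi by (simp add: ev_one_def Perm_apply subsetD)
    also have "\<dots> = (inv\<^bsub>Perm G\<^esub> g \<otimes>\<^bsub>Perm G\<^esub> g) \<one>"
      using fg sub gi by (simp add: Perm_apply subsetD)
    also have "\<dots> = \<one>" using P.l_inv[of g] fg sub carr by (simp add: subsetD) (simp add: BijGroup_def)
    finally have "?h = \<one>\<^bsub>Perm G\<^esub>"
      using assms hN one_closed unfolding regular_subgroup_def by blast
    then show "f = g"
      using fg sub carr by (metis P.inv_equality P.inv_inv P.inv_closed subsetD)
  qed
  moreover have "ev_one G ` N = carrier G"
  proof
    show "ev_one G ` N \<subseteq> carrier G"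
      using sub by (auto simp: ev_one_def dest!: subsetD Bij_imp_funcset)
    show "carrier G \<subseteq> ev_one G ` N"
    proof
      fix y assume "y \<in> carrier G"
      then obtain h where "h \<in> N" "h \<one> = y"
        using assms one_closed unfolding regular_subgroup_def by meson
      then show "y \<in> ev_one G ` N" by (auto simp: ev_one_def)
    qed
  qed
  ultimately show ?thesis by (simp add: bij_betw_def)
qed

lemma (in group) conj_mult_mult:
  assumes "l \<in> carrier G" "x \<in> carrier G" "y \<in> carrier G" "z \<in> carrier G"
  shows "l \<otimes> (y \<otimes> z) \<otimes> inv l \<otimes> x = l \<otimes> y \<otimes> inv l \<otimes> x \<otimes> inv x \<otimes> (l \<otimes> z \<otimes> inv l \<otimes> x)"
proof -
  have "inv l \<otimes> (l \<otimes> w) = w" "x \<otimes> (inv x \<otimes> w) = w" if "w \<in> carrier G" for w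
    using assms that by (simp_all flip: m_assoc)
  then show ?thesis using assms by (simp add: m_assoc)
qed

lemma (in group) skew_brace_brace_of:
  assumes "finite (carrier G)" "regular_subgroup G N" "G_stable G N"
  shows "skew_brace (brace_of G N)"
proof -
  interpret P: group "Perm G" by (rule group_BijGroup)
  let ?a = "ev_one G" and ?c = "circ (brace_of G N)"
  have carr: "carrier (Perm G) = Bij (carrier G)" by (simp add: BijGroup_def)
  have N: "subgroup N (Perm G)" using assms by (simp add: regular_subgroup_def)
  have sub: "N \<subseteq> Bij (carrier G)" using subgroup.subset[OF N] carr by simp
  have bij: "bij_betw ?a N (carrier G)" by (rule ev_one_bij_betw[OF assms(2)])
  have aG: "?a x \<in> carrier G" if "x \<in> N" for x using bij that by (auto simp: bij_betw_def)
  have ainj: "x = y" if "?a x = ?a y" "x \<in> N" "y \<in> N" for x y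
    using bij that by (auto simp: bij_betw_def inj_on_def)
  have cN: "?c x y \<in> N" if "x \<in> N" "y \<in> N" for x y
    using bij that aG by (simp add: brace_of_def bij_betw_def inv_into_into)
  have ac: "?a (?c x y) = ?a x \<otimes> ?a y" if "x \<in> N" "y \<in> N" for x y
    using bij that aG by (simp add: brace_of_def bij_betw_def f_inv_into_f)
  obtain e where e: "e \<in> N" "?a e = \<one>"
    using bij one_closed unfolding bij_betw_def by (metis imageE)
  have fin: "finite N" using bij assms(1) bij_betw_finite by blast
  have "group \<lparr>carrier = N, mult = ?c, one = e\<rparr>"
  proof (rule groupI; clarsimp)
    fix x y z assume "x \<in> N" "y \<in> N" "z \<in> N"
    then show "?c (?c x y) z = ?c x (?c y z)"
      by (intro ainj) (auto simp: ac cN aG m_assoc)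
  next
    fix x assume x: "x \<in> N"
    show "?c e x = x" using x e by (intro ainj) (auto simp: ac cN aG)
    obtain y where "y \<in> N" "?a y = inv (?a x)"
      using bij inv_closed[OF aG[OF x]] unfolding bij_betw_def by (metis imageE)
    then show "\<exists>y\<in>N. ?c y x = e"
      using x e by (intro bexI[of _ y] ainj) (auto simp: ac cN aG)
  qed (auto simp: cN e)
  moreover have gB: "group (brace_of G N)"
  proof (rule groupI)
    fix x assume "x \<in> carrier (brace_of G N)"
    then have "x \<in> N" by (simp add: brace_of_def)
    then show "\<exists>y\<in>carrier (brace_of G N). y \<otimes>\<^bsub>brace_of G N\<^esub> x = \<one>\<^bsub>brace_of G N\<^esub>"
      using subgroup.m_inv_closed[OF N] P.l_inv[of x] sub carr
      by (auto simp: brace_of_def subset_iff intro!: bexI[of _ "inv\<^bsub>Perm G\<^esub> x"])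
  qed (use N sub carr in \<open>auto simp: brace_of_def subgroup.m_closed subgroup.one_closed subset_iff P.m_assoc\<close>)
  have invB: "inv\<^bsub>brace_of G N\<^esub> x = inv\<^bsub>Perm G\<^esub> x" if "x \<in> N" for x
  proof -
    interpret B: group "brace_of G N" by (rule gB)
    show ?thesis
      using that N sub carr
      using P.l_inv[of x]
      by (intro B.inv_equality) (auto simp: brace_of_def subgroup.m_inv_closed)
  qed
  have c_eq: "?c x y = perm_act G (?a x) y \<otimes>\<^bsub>Perm G\<^esub> x" if xy: "x \<in> N" "y \<in> N" for x y
  proof (rule ainj)
    have pN: "perm_act G (?a x) y \<in> N"
      using assms(3) xy aG by (simp add: G_stable_def)
    show "perm_act G (?a x) y \<otimes>\<^bsub>Perm G\<^esub> x \<in> N"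
      using pN xy N by (simp add: subgroup.m_closed)
    have "?a (perm_act G (?a x) y \<otimes>\<^bsub>Perm G\<^esub> x) = perm_act G (?a x) y (?a x)"
      using pN xy sub by (simp add: ev_one_def Perm_apply subsetD)
    also have "\<dots> = ?a x \<otimes> y (inv (?a x) \<otimes> ?a x)"
      using xy sub aG by (intro perm_act_left_reg) auto
    finally show "?a (?c x y) = ?a (perm_act G (?a x) y \<otimes>\<^bsub>Perm G\<^esub> x)"
      using xy aG by (simp add: ac) (simp add: ev_one_def)
  qed (use xy cN in auto)
  have "?c x (y \<otimes>\<^bsub>Perm G\<^esub> z) = ?c x y \<otimes>\<^bsub>Perm G\<^esub> inv\<^bsub>Perm G\<^esub> x \<otimes>\<^bsub>Perm G\<^esub> ?c x z"
    if xyz: "x \<in> N" "y \<in> N" "z \<in> N" for x y z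
  proof -
    let ?l = "left_reg G (?a x)"
    have l: "?l \<in> carrier (Perm G)" using left_reg_in_Bij aG xyz carr by simp
    have m: "x \<in> carrier (Perm G)" "y \<in> carrier (Perm G)" "z \<in> carrier (Perm G)"
      using xyz sub carr by auto
    have "y \<otimes>\<^bsub>Perm G\<^esub> z \<in> N" using xyz N by (simp add: subgroup.m_closed)
    then show ?thesis
      using xyz P.conj_mult_mult[OF l m] by (simp add: c_eq perm_act_def)
  qed
  then have "\<forall>x\<in>N. \<forall>y\<in>N. \<forall>z\<in>N. ?c x (y \<otimes>\<^bsub>brace_of G N\<^esub> z) =
      ?c x y \<otimes>\<^bsub>brace_of G N\<^esub> inv\<^bsub>brace_of G N\<^esub> x \<otimes>\<^bsub>brace_of G N\<^esub> ?c x z"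
    using invB by (simp add: brace_of_def)
  moreover have "carrier (brace_of G N) = N" by (simp add: brace_of_def)
  ultimately show ?thesis using gB fin unfolding skew_brace_def by metis
qed

lemma (in group) N_of_apply:
  assumes "\<psi> \<in> hom G G" "\<sigma> \<in> carrier G" "\<tau> \<in> carrier G"
  shows "(left_reg G \<sigma> \<otimes>\<^bsub>Perm G\<^esub> inner_aut G (\<psi> (inv \<sigma>))) \<tau> =
    \<sigma> \<otimes> \<psi> (inv \<sigma>) \<otimes> \<tau> \<otimes> \<psi> \<sigma>"
proof -
  interpret h: group_hom G G \<psi>
    by unfold_locales (rule assms(1))
  show ?thesis
    using assms h.hom_closed
    by (simp add: Perm_apply left_reg_in_Bij inner_aut_in_Bij)
       (simp add: left_reg_def inner_aut_def m_assoc)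
qed

lemma (in group) regular_G_stable_N_of:
  assumes "abelian_endomorphism G \<psi>"
  shows "regular_subgroup G (N_of G \<psi>)" "G_stable G (N_of G \<psi>)"
proof -
  interpret P: group "Perm G" by (rule group_BijGroup)
  have carr: "carrier (Perm G) = Bij (carrier G)" by (simp add: BijGroup_def)
  have hom: "\<psi> \<in> hom G G" using assms by (simp add: abelian_endomorphism_def)
  interpret h: group_hom G G \<psi> by unfold_locales (rule hom)
  let ?n = "\<lambda>s. left_reg G s \<otimes>\<^bsub>Perm G\<^esub> inner_aut G (\<psi> (inv s))"
  have comm: "\<psi> x \<otimes> \<psi> y = \<psi> y \<otimes> \<psi> x" if "x \<in> carrier G" "y \<in> carrier G" for x y
    using assms that by (simp add: abelian_endomorphism_def flip: h.hom_mult)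
  have c1: "x \<otimes> (inv x \<otimes> w) = w" "inv x \<otimes> (x \<otimes> w) = w"
    if "x \<in> carrier G" "w \<in> carrier G" for x w
    using that by (simp_all flip: m_assoc)
  have ap: "?n s x = s \<otimes> inv (\<psi> s) \<otimes> x \<otimes> \<psi> s" if "s \<in> carrier G" "x \<in> carrier G" for s x
    using N_of_apply[OF hom that] that by simp
  have nB: "?n s \<in> Bij (carrier G)" if "s \<in> carrier G" for s
    using that left_reg_in_Bij inner_aut_in_Bij P.m_closed carr by (metis h.hom_closed inv_closed)
  have eqI: "p = ?n s" if "p \<in> Bij (carrier G)" "s \<in> carrier G"
    "\<And>x. x \<in> carrier G \<Longrightarrow> p x = s \<otimes> inv (\<psi> s) \<otimes> x \<otimes> \<psi> s" for p s
    using that nB[OF that(2)] ap by (intro extensionalityI[of _ "carrier G"]) (auto simp: Bij_def)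
  have inN: "?n s \<in> N_of G \<psi>" if "s \<in> carrier G" for s
    using that unfolding N_of_def by blast
  have NB: "N_of G \<psi> \<subseteq> Bij (carrier G)" using nB by (auto simp: N_of_def)
  have free: "\<eta> = \<one>\<^bsub>Perm G\<^esub>" if x: "x \<in> carrier G" and "\<eta> \<in> N_of G \<psi>" "\<eta> x = x" for x \<eta>
  proof -
    obtain s where s: "s \<in> carrier G" "\<eta> = ?n s" using \<open>\<eta> \<in> _\<close> unfolding N_of_def by blast
    have e: "s \<otimes> \<psi> (inv s) \<otimes> x \<otimes> \<psi> s = x" using that s ap by simp
    have "\<psi> (s \<otimes> \<psi> (inv s) \<otimes> x \<otimes> \<psi> s) = \<psi> s \<otimes> (inv (\<psi> (\<psi> s)) \<otimes> (\<psi> (\<psi> s) \<otimes> \<psi> x))"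
      using s x comm[of x "\<psi> s"] by (simp add: m_assoc)
    then have "\<psi> s \<otimes> \<psi> x = \<psi> x" unfolding e using s x by (simp add: c1)
    then have "\<psi> s = \<one>" using s x by (simp add: r_cancel_one)
    then have "s = \<one>" using e s x by simp
    then have "\<eta> y = y" if "y \<in> carrier G" for y using s ap[OF s(1) that] that by simp
    then show ?thesis
      using s nB by (intro extensionalityI[of _ "carrier G"]) (auto simp: BijGroup_def Bij_def)
  qed
  have trans: "\<exists>\<eta>\<in>N_of G \<psi>. \<eta> x = y" if "x \<in> carrier G" "y \<in> carrier G" for x y
  proof -
    define c where "c = \<psi> (y \<otimes> inv x)"
    let ?s = "y \<otimes> inv c \<otimes> inv x \<otimes> c"
    have c: "c \<in> carrier G" using that by (simp add: c_def)
    have s: "?s \<in> carrier G" using c that by simp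
    have "\<psi> ?s = \<psi> y \<otimes> (inv (\<psi> c) \<otimes> (\<psi> c \<otimes> inv (\<psi> x)))"
      using that c comm[of "inv x" c] by (simp add: m_assoc)
    then have "\<psi> ?s = c" using that c by (simp add: c1) (simp add: c_def)
    then have "?n ?s x = y"
      unfolding ap[OF s that(1)] using c that by (simp only:) (simp add: m_assoc c1)
    then show ?thesis using inN s by blast
  qed
  have mult: "p \<otimes>\<^bsub>Perm G\<^esub> q \<in> N_of G \<psi>" if "p \<in> N_of G \<psi>" "q \<in> N_of G \<psi>" for p q
  proof -
    obtain s where s: "s \<in> carrier G" "p = ?n s" using \<open>p \<in> _\<close> unfolding N_of_def by blast
    obtain t where t: "t \<in> carrier G" "q = ?n t" using \<open>q \<in> _\<close> unfolding N_of_def by blast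
    note st = s t
    let ?r = "s \<otimes> \<psi> (inv s) \<otimes> t \<otimes> \<psi> s"
    have r: "?r \<in> carrier G" using st by simp
    have "\<psi> ?r = \<psi> s \<otimes> (inv (\<psi> (\<psi> s)) \<otimes> (\<psi> (\<psi> s) \<otimes> \<psi> t))"
      using st comm[of t "\<psi> s"] by (simp add: m_assoc)
    then have pr: "\<psi> ?r = \<psi> t \<otimes> \<psi> s" using st comm[of s t] by (simp add: c1)
    have "p \<otimes>\<^bsub>Perm G\<^esub> q = ?n ?r"
    proof (rule eqI)
      show "p \<otimes>\<^bsub>Perm G\<^esub> q \<in> Bij (carrier G)" using st nB P.m_closed carr by metis
      fix x assume x: "x \<in> carrier G"
      show "(p \<otimes>\<^bsub>Perm G\<^esub> q) x = ?r \<otimes> inv (\<psi> ?r) \<otimes> x \<otimes> \<psi> ?r"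
        unfolding pr st(2,4) using st x
        by (simp add: Perm_apply[OF nB nB] ap inv_mult_group m_assoc c1 del: h.hom_inv)
           (simp add: m_assoc c1)
    qed (rule r)
    then show ?thesis using inN r by simp
  qed
  have one: "\<one>\<^bsub>Perm G\<^esub> \<in> N_of G \<psi>"
    using free[OF one_closed inN[OF one_closed]] inN[OF one_closed] ap[of \<one> \<one>] by simp
  have "inv\<^bsub>Perm G\<^esub> p \<in> N_of G \<psi>" if p: "p \<in> N_of G \<psi>" for p
  proof -
    have pc: "p \<one> \<in> carrier G" "p \<in> carrier (Perm G)" using subsetD[OF NB p] carr Bij_imp_funcset[of p] by auto
    obtain q where q: "q \<in> N_of G \<psi>" "q (p \<one>) = \<one>" using trans[of "p \<one>" \<one>] pc by auto
    have "(q \<otimes>\<^bsub>Perm G\<^esub> p) \<one> = \<one>" using q p NB by (simp add: Perm_apply subsetD)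
    then have "q \<otimes>\<^bsub>Perm G\<^esub> p = \<one>\<^bsub>Perm G\<^esub>" using free mult q p one_closed by blast
    then have "inv\<^bsub>Perm G\<^esub> p = q" using pc q NB carr by (intro P.inv_equality) auto
    then show ?thesis using q by simp
  qed
  then have "subgroup (N_of G \<psi>) (Perm G)"
    using NB carr one mult by (intro P.subgroupI) auto
  then show "regular_subgroup G (N_of G \<psi>)"
    using trans free by (auto simp: regular_subgroup_def)
  show "G_stable G (N_of G \<psi>)"
    unfolding G_stable_def
  proof (intro ballI)
    fix g p assume g: "g \<in> carrier G" and "p \<in> N_of G \<psi>"
    then obtain s where s: "s \<in> carrier G" "p = ?n s" unfolding N_of_def by blast
    let ?r = "g \<otimes> s \<otimes> \<psi> (inv s) \<otimes> inv g \<otimes> \<psi> s"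
    have r: "?r \<in> carrier G" using s g by simp
    have "\<psi> ?r = \<psi> (g \<otimes> (s \<otimes> \<psi> (inv s) \<otimes> inv g \<otimes> \<psi> s))"
      using s g by (simp add: m_assoc)
    also have "\<dots> = \<psi> (s \<otimes> \<psi> (inv s) \<otimes> inv g \<otimes> \<psi> s \<otimes> g)"
      using assms s g by (simp add: abelian_endomorphism_def del: h.hom_mult)
    also have "\<dots> = \<psi> s \<otimes> (inv (\<psi> (\<psi> s)) \<otimes> (\<psi> (\<psi> s) \<otimes> (inv (\<psi> g) \<otimes> \<psi> g)))"
      using s g comm[of "inv g" "\<psi> s"] by (simp add: m_assoc flip: m_assoc[of "inv (\<psi> g)"])
    finally have pr: "\<psi> ?r = \<psi> s" using s g by (simp add: c1)
    have "perm_act G g p = ?n ?r"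
    proof (rule eqI)
      show "perm_act G g p \<in> Bij (carrier G)" using perm_act_closed g s nB by simp
      fix x assume x: "x \<in> carrier G"
      show "perm_act G g p x = ?r \<otimes> inv (\<psi> ?r) \<otimes> x \<otimes> \<psi> ?r"
        unfolding pr s(2) using s x g
        by (simp add: perm_act_left_reg[OF _ nB] ap m_assoc c1 del: h.hom_inv) simp
    qed (rule r)
    then show "perm_act G g p \<in> N_of G \<psi>" using inN r by simp
  qed
qed

end

theory Submission
  imports Defs
begin

text \<open>
  For a regular \<open>G\<close>-stable subgroup \<open>N\<close>, evaluation at the identity identifies \<open>N\<close> with \<open>G\<close>, and
  the circle operation of its brace is \<open>\<eta> \<circ> \<pi> = \<^bsup>\<sigma>\<^esup>\<pi> \<cdot> \<eta>\<close> with \<open>\<sigma> = \<eta>[1]\<close>.  The brace therefore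
  remembers the action of \<open>G\<close> on \<open>N\<close>, except for the names of the acting elements: a brace
  isomorphism \<open>f : N \<rightarrow> M\<close> is an isomorphism for composition satisfying \<open>f(\<^bsup>\<sigma>\<^esup>\<eta>) = \<^bsup>\<phi>(\<sigma>)\<^esup>f(\<eta>)\<close>, where
  \<open>\<phi>\<close> is the automorphism of \<open>G\<close> that \<open>f\<close> induces through the two evaluation maps
  (\<open>brace_equivalent_twisted_iso\<close>).

  On the other hand, being \<open>G\<close>-isomorphic to \<open>\<lambda>(G)\<close> means that there is an isomorphism
  \<open>k : N \<rightarrow> G\<close> turning the action into conjugation (\<open>G_isomorphic_left_reg\<close>), and this property
  survives twisting by \<open>\<phi>\<close>: replace \<open>k\<close> by \<open>\<phi>\<^sup>-\<^sup>1 \<circ> k \<circ> f\<close>.  It remains to find \<open>k\<close> for \<open>N\<^sub>\<psi>\<close>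
  (\<open>N_of_conj_iso\<close>).  The element attached to \<open>s\<close> is \<open>\<tau> \<mapsto> h(s) \<tau> \<psi>(s)\<close> with \<open>h(s) = s \<psi>(s)\<^sup>-\<^sup>1\<close>, and
  since \<open>\<psi>\<close> is trivial on commutators the assignment of \<open>h(s)\<close> to this element is an equivariant
  homomorphism.  Its injectivity is exactly the statement that \<open>\<psi>\<close> has no nontrivial fixed point, and
  surjectivity follows by finiteness.
\<close>

section \<open>The action encoded in the brace\<close>

context group
begin

lemma regular_subgroup_Bij:
  assumes "regular_subgroup G N"
  shows "N \<subseteq> Bij (carrier G)"
  using subgroup.subset[of N "Perm G"] assms
  by (simp add: regular_subgroup_def BijGroup_def)

lemma ev_one_closed:
  assumes "regular_subgroup G N" "\<eta> \<in> N"
  shows "ev_one G \<eta> \<in> carrier G"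
  using ev_one_bij_betw[OF assms(1)] assms(2) by (rule bij_betw_apply)

lemma ev_one_mult:
  assumes "regular_subgroup G N" "\<eta> \<in> N" "\<pi> \<in> N"
  shows "ev_one G (\<eta> \<otimes>\<^bsub>Perm G\<^esub> \<pi>) = \<eta> (ev_one G \<pi>)"
  using regular_subgroup_Bij[OF assms(1)] assms by (simp add: ev_one_def Perm_apply subsetD)

lemma circ_brace_of_closed:
  assumes "regular_subgroup G N" "\<eta> \<in> N" "\<pi> \<in> N"
  shows "circ (brace_of G N) \<eta> \<pi> \<in> N"
  using ev_one_bij_betw[OF assms(1)] assms ev_one_closed
  by (simp add: brace_of_def bij_betw_def inv_into_into)

lemma ev_one_circ_brace_of:
  assumes "regular_subgroup G N" "\<eta> \<in> N" "\<pi> \<in> N"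
  shows "ev_one G (circ (brace_of G N) \<eta> \<pi>) = ev_one G \<eta> \<otimes> ev_one G \<pi>"
  using ev_one_bij_betw[OF assms(1)] assms ev_one_closed
  by (simp add: brace_of_def bij_betw_def f_inv_into_f)

text \<open>
  Both sides lie in \<open>N\<close>, where a permutation is determined by its value at the identity, and this
  value is \<open>\<eta>[1] \<pi>[1]\<close>: on the right-hand side the translation by \<open>\<eta>[1]\<^sup>-\<^sup>1\<close> inside the action
  cancels the value \<open>\<eta>[1]\<close>.
\<close>
lemma circ_brace_of_eq:
  assumes reg: "regular_subgroup G N" and "G_stable G N" and mem: "\<eta> \<in> N" "\<pi> \<in> N"
  shows "circ (brace_of G N) \<eta> \<pi> = perm_act G (ev_one G \<eta>) \<pi> \<otimes>\<^bsub>Perm G\<^esub> \<eta>"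
proof -
  have a: "ev_one G \<eta> \<in> carrier G" "ev_one G \<pi> \<in> carrier G"
    using ev_one_closed[OF reg] mem by auto
  have act: "perm_act G (ev_one G \<eta>) \<pi> \<in> N"
    using assms a by (simp add: G_stable_def)
  have "subgroup N (Perm G)" using reg by (simp add: regular_subgroup_def)
  then have prod: "perm_act G (ev_one G \<eta>) \<pi> \<otimes>\<^bsub>Perm G\<^esub> \<eta> \<in> N"
    using act mem by (simp add: subgroup.m_closed)
  have "ev_one G (perm_act G (ev_one G \<eta>) \<pi> \<otimes>\<^bsub>Perm G\<^esub> \<eta>)
      = ev_one G \<eta> \<otimes> \<pi> (inv (ev_one G \<eta>) \<otimes> ev_one G \<eta>)"
    using perm_act_left_reg regular_subgroup_Bij[OF reg] mem a
    by (simp only: ev_one_mult[OF reg act mem(1)] subsetD)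
  also have "\<dots> = ev_one G (circ (brace_of G N) \<eta> \<pi>)"
    using a by (simp add: ev_one_circ_brace_of[OF reg mem]) (simp add: ev_one_def)
  finally show ?thesis
    using ev_one_bij_betw[OF reg] circ_brace_of_closed[OF reg mem] prod
    by (auto simp: bij_betw_def dest: inj_onD)
qed

text \<open>
  The automorphism is \<open>\<phi> = a \<circ> f \<circ> a\<^sup>-\<^sup>1\<close>: it is multiplicative because \<open>f\<close> respects the circle
  operations, which evaluation at the identity turns into the multiplication of \<open>G\<close>.  Comparing the
  description of \<open>\<circ>\<close> through the action on both sides and cancelling the factor \<open>f(\<eta>)\<close> gives the
  twisted equivariance.
\<close>
lemma brace_equivalent_twisted_iso:
  assumes N: "regular_subgroup G N" "G_stable G N"
    and M: "regular_subgroup G M" "G_stable G M"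
    and "brace_equivalent G N M"
  obtains f \<phi> where "f \<in> iso ((Perm G)\<lparr>carrier := N\<rparr>) ((Perm G)\<lparr>carrier := M\<rparr>)"
    and "\<phi> \<in> iso G G"
    and "\<And>\<sigma> \<eta>. \<lbrakk>\<sigma> \<in> carrier G; \<eta> \<in> N\<rbrakk> \<Longrightarrow> f (perm_act G \<sigma> \<eta>) = perm_act G (\<phi> \<sigma>) (f \<eta>)"
proof -
  interpret P: group "Perm G" by (rule group_BijGroup)
  have carr: "carrier (Perm G) = Bij (carrier G)" by (simp add: BijGroup_def)
  obtain f where f: "bij_betw f N M"
    and f_mult: "\<And>x y. \<lbrakk>x \<in> N; y \<in> N\<rbrakk> \<Longrightarrow> f (x \<otimes>\<^bsub>Perm G\<^esub> y) = f x \<otimes>\<^bsub>Perm G\<^esub> f y"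
    and f_circ: "\<And>x y. \<lbrakk>x \<in> N; y \<in> N\<rbrakk> \<Longrightarrow>
      f (circ (brace_of G N) x y) = circ (brace_of G M) (f x) (f y)"
  proof -
    have "carrier (brace_of G K) = K" "mult (brace_of G K) = mult (Perm G)" for K
      by (simp_all add: brace_of_def)
    then show ?thesis
      using that assms(5) unfolding brace_equivalent_def brace_isomorphic_def by metis
  qed
  have fM: "f x \<in> M" if "x \<in> N" for x using f that by (rule bij_betw_apply)
  define a' where "a' = inv_into N (ev_one G)"
  have a': "bij_betw a' (carrier G) N"
    unfolding a'_def using ev_one_bij_betw[OF N(1)] by (rule bij_betw_inv_into)
  have a'N: "a' \<sigma> \<in> N" if "\<sigma> \<in> carrier G" for \<sigma> using a' that by (rule bij_betw_apply)
  have a_a': "ev_one G (a' \<sigma>) = \<sigma>" if "\<sigma> \<in> carrier G" for \<sigma>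
    unfolding a'_def using ev_one_bij_betw[OF N(1)] that by (rule bij_betw_inv_into_right)
  have a'_mult: "a' (\<sigma> \<otimes> \<tau>) = circ (brace_of G N) (a' \<sigma>) (a' \<tau>)"
    if "\<sigma> \<in> carrier G" "\<tau> \<in> carrier G" for \<sigma> \<tau>
    using that by (simp add: brace_of_def a_a') (simp add: a'_def)
  define \<phi> where "\<phi> = (\<lambda>\<sigma>. ev_one G (f (a' \<sigma>)))"
  have "bij_betw \<phi> (carrier G) (carrier G)"
    unfolding \<phi>_def using bij_betw_trans[OF bij_betw_trans[OF a' f] ev_one_bij_betw[OF M(1)]]
    by (simp add: comp_def)
  moreover have "\<phi> (\<sigma> \<otimes> \<tau>) = \<phi> \<sigma> \<otimes> \<phi> \<tau>" if "\<sigma> \<in> carrier G" "\<tau> \<in> carrier G" for \<sigma> \<tau>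
    using that by (simp add: \<phi>_def a'_mult f_circ a'N fM ev_one_circ_brace_of[OF M(1)])
  ultimately have \<phi>: "\<phi> \<in> iso G G"
    by (auto simp: iso_def hom_def bij_betw_def)
  have "f (perm_act G \<sigma> \<eta>) = perm_act G (\<phi> \<sigma>) (f \<eta>)" if \<sigma>: "\<sigma> \<in> carrier G" and \<eta>: "\<eta> \<in> N" for \<sigma> \<eta>
  proof -
    have act: "perm_act G \<sigma> \<eta> \<in> N" using N(2) \<sigma> \<eta> by (simp add: G_stable_def)
    have "\<phi> \<sigma> \<in> carrier G" using \<phi> \<sigma> by (auto simp: iso_def hom_def)
    then have act': "perm_act G (\<phi> \<sigma>) (f \<eta>) \<in> M" using M(2) fM[OF \<eta>] by (simp add: G_stable_def)
    have "f (perm_act G \<sigma> \<eta>) \<otimes>\<^bsub>Perm G\<^esub> f (a' \<sigma>) = f (circ (brace_of G N) (a' \<sigma>) \<eta>)"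
      using act \<sigma> \<eta> by (simp add: circ_brace_of_eq[OF N] a'N a_a' f_mult)
    also have "\<dots> = perm_act G (\<phi> \<sigma>) (f \<eta>) \<otimes>\<^bsub>Perm G\<^esub> f (a' \<sigma>)"
      using \<sigma> \<eta> by (simp add: f_circ a'N circ_brace_of_eq[OF M] fM \<phi>_def)
    finally show ?thesis
      using act act' \<sigma> fM a'N regular_subgroup_Bij[OF M(1)] carr by (metis P.right_cancel subsetD)
  qed
  moreover have "f \<in> iso ((Perm G)\<lparr>carrier := N\<rparr>) ((Perm G)\<lparr>carrier := M\<rparr>)"
    using f f_mult fM by (auto simp: iso_def hom_def)
  ultimately show ?thesis using that \<phi> by blast
qed

section \<open>Subgroups on which the action is conjugation\<close>

lemma left_reg_iso:
  "left_reg G \<in> iso G ((Perm G)\<lparr>carrier := left_reg G ` carrier G\<rparr>)"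
proof -
  have "left_reg G (\<sigma> \<otimes> \<tau>) = left_reg G \<sigma> \<otimes>\<^bsub>Perm G\<^esub> left_reg G \<tau>"
    if "\<sigma> \<in> carrier G" "\<tau> \<in> carrier G" for \<sigma> \<tau>
    using that left_reg_in_Bij
    by (auto simp: BijGroup_def compose_def left_reg_def m_assoc fun_eq_iff)
  moreover have "inj_on (left_reg G) (carrier G)"
  proof (rule inj_onI)
    fix \<sigma> \<tau> assume "\<sigma> \<in> carrier G" "\<tau> \<in> carrier G" "left_reg G \<sigma> = left_reg G \<tau>"
    then show "\<sigma> = \<tau>" by (auto simp: left_reg_def dest: fun_cong[where x = \<one>])
  qed
  ultimately show ?thesis by (auto simp: iso_def hom_def bij_betw_def)
qed

lemma perm_act_of_left_reg:
  assumes "\<sigma> \<in> carrier G" "\<tau> \<in> carrier G"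
  shows "perm_act G \<sigma> (left_reg G \<tau>) = left_reg G (\<sigma> \<otimes> \<tau> \<otimes> inv \<sigma>)"
proof (rule extensionalityI[of _ "carrier G"])
  show "perm_act G \<sigma> (left_reg G \<tau>) \<in> extensional (carrier G)"
    using perm_act_closed[OF assms(1) left_reg_in_Bij[OF assms(2)]] by (simp add: Bij_def)
  show "left_reg G (\<sigma> \<otimes> \<tau> \<otimes> inv \<sigma>) \<in> extensional (carrier G)"
    by (simp add: left_reg_def)
  fix x assume "x \<in> carrier G"
  then show "perm_act G \<sigma> (left_reg G \<tau>) x = left_reg G (\<sigma> \<otimes> \<tau> \<otimes> inv \<sigma>) x"
    using assms
    by (simp add: perm_act_left_reg left_reg_in_Bij) (simp add: left_reg_def m_assoc)
qed

text \<open>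
  Through \<open>\<lambda>\<close> the action of \<open>G\<close> on \<open>\<lambda>(G)\<close> is conjugation in \<open>G\<close>, so \<open>\<lambda>(G)\<close> may be replaced by \<open>G\<close>
  itself as the target.
\<close>
lemma G_isomorphic_left_reg:
  assumes k: "k \<in> iso ((Perm G)\<lparr>carrier := N\<rparr>) G"
    and conj: "\<And>\<sigma> \<eta>. \<lbrakk>\<sigma> \<in> carrier G; \<eta> \<in> N\<rbrakk> \<Longrightarrow> k (perm_act G \<sigma> \<eta>) = \<sigma> \<otimes> k \<eta> \<otimes> inv \<sigma>"
  shows "G_isomorphic G N (left_reg G ` carrier G)"
  unfolding G_isomorphic_def
proof (intro bexI ballI)
  show "left_reg G \<circ> k \<in> iso ((Perm G)\<lparr>carrier := N\<rparr>) ((Perm G)\<lparr>carrier := left_reg G ` carrier G\<rparr>)"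
    using k left_reg_iso by (rule iso_set_trans)
  fix \<eta> \<sigma> assume "\<eta> \<in> N" "\<sigma> \<in> carrier G"
  moreover from \<open>\<eta> \<in> N\<close> have "k \<eta> \<in> carrier G" using k by (auto simp: iso_def hom_def)
  ultimately show "(left_reg G \<circ> k) (perm_act G \<sigma> \<eta>) = perm_act G \<sigma> ((left_reg G \<circ> k) \<eta>)"
    by (simp add: conj perm_act_of_left_reg)
qed

lemma N_of_value:
  assumes "abelian_endomorphism G \<psi>" "\<eta> \<in> N_of G \<psi>" "\<tau> \<in> carrier G"
  shows "\<eta> \<tau> = ev_one G \<eta> \<otimes> inv (\<psi> (ev_one G \<eta>)) \<otimes> \<tau> \<otimes> \<psi> (ev_one G \<eta>)"
proof -
  have hom: "\<psi> \<in> hom G G" using assms(1) by (simp add: abelian_endomorphism_def)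
  interpret h: group_hom G G \<psi> by unfold_locales (rule hom)
  obtain s where s: "s \<in> carrier G" "\<eta> = left_reg G s \<otimes>\<^bsub>Perm G\<^esub> inner_aut G (\<psi> (inv s))"
    using assms(2) unfolding N_of_def by blast
  have "\<eta> x = s \<otimes> inv (\<psi> s) \<otimes> x \<otimes> \<psi> s" if "x \<in> carrier G" for x
    using N_of_apply[OF hom s(1) that] s by simp
  moreover from this[OF one_closed] have "ev_one G \<eta> = s"
    using s(1) by (simp add: ev_one_def m_assoc)
  ultimately show ?thesis using assms(3) by simp
qed

text \<open>
  If \<open>\<sigma> \<psi>(\<sigma>)\<^sup>-\<^sup>1 = \<tau> \<psi>(\<tau>)\<^sup>-\<^sup>1\<close>, then \<open>\<tau>\<^sup>-\<^sup>1\<sigma>\<close> is a fixed point of \<open>\<psi>\<close>.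
\<close>
lemma fixed_point_free_bij_betw:
  assumes "finite (carrier G)" "\<psi> \<in> hom G G" "fixed_point_free G \<psi>"
  shows "bij_betw (\<lambda>\<sigma>. \<sigma> \<otimes> inv (\<psi> \<sigma>)) (carrier G) (carrier G)"
proof -
  interpret h: group_hom G G \<psi> by unfold_locales (rule assms(2))
  have "inj_on (\<lambda>\<sigma>. \<sigma> \<otimes> inv (\<psi> \<sigma>)) (carrier G)"
  proof (rule inj_onI)
    fix \<sigma> \<tau> assume mem: "\<sigma> \<in> carrier G" "\<tau> \<in> carrier G"
      and eq: "\<sigma> \<otimes> inv (\<psi> \<sigma>) = \<tau> \<otimes> inv (\<psi> \<tau>)"
    have "inv \<tau> \<otimes> \<sigma> = inv \<tau> \<otimes> (\<sigma> \<otimes> inv (\<psi> \<sigma>)) \<otimes> \<psi> \<sigma>"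
      using mem by (simp add: m_assoc)
    also have "\<dots> = inv \<tau> \<otimes> \<tau> \<otimes> inv (\<psi> \<tau>) \<otimes> \<psi> \<sigma>"
      unfolding eq using mem by (simp only: m_assoc inv_closed h.hom_closed m_closed)
    also have "\<dots> = \<psi> (inv \<tau> \<otimes> \<sigma>)"
      using mem by simp
    finally have "inv \<tau> \<otimes> \<sigma> = \<one>"
      using assms(3) mem unfolding fixed_point_free_def by (metis m_closed inv_closed)
    then show "\<sigma> = \<tau>"
      using mem by (metis inv_equality inv_closed inv_inv)
  qed
  moreover have "(\<lambda>\<sigma>. \<sigma> \<otimes> inv (\<psi> \<sigma>)) ` carrier G \<subseteq> carrier G" by auto
  ultimately show ?thesis
    using assms(1) by (simp add: bij_betw_def endo_inj_surj)
qed

text \<open>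
  The element of \<open>N\<^sub>\<psi>\<close> attached to \<open>s\<close> takes the identity to \<open>s\<close>, so its image under \<open>k\<close> is
  \<open>h(s) = s \<psi>(s)\<^sup>-\<^sup>1\<close>.  Multiplying it by the element attached to \<open>t\<close>, or acting on it with \<open>g\<close>,
  changes \<open>s\<close> into \<open>h(s) t \<psi>(s)\<close> or \<open>g h(s) g\<^sup>-\<^sup>1 \<psi>(s)\<close>.  Because \<open>\<psi>\<close> has
  abelian image, it takes the values \<open>\<psi>(s) \<psi>(t)\<close> and \<open>\<psi>(s)\<close> there, and dividing by them leaves
  \<open>h(s) h(t)\<close> and \<open>g h(s) g\<^sup>-\<^sup>1\<close>.
\<close>
lemma N_of_conj_iso:
  assumes "finite (carrier G)" and ab: "abelian_endomorphism G \<psi>" and "fixed_point_free G \<psi>"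
  defines "k \<equiv> \<lambda>\<eta>. ev_one G \<eta> \<otimes> inv (\<psi> (ev_one G \<eta>))"
  shows "k \<in> iso ((Perm G)\<lparr>carrier := N_of G \<psi>\<rparr>) G"
    and "\<And>\<sigma> \<eta>. \<lbrakk>\<sigma> \<in> carrier G; \<eta> \<in> N_of G \<psi>\<rbrakk> \<Longrightarrow> k (perm_act G \<sigma> \<eta>) = \<sigma> \<otimes> k \<eta> \<otimes> inv \<sigma>"
proof -
  have hom: "\<psi> \<in> hom G G" using ab by (simp add: abelian_endomorphism_def)
  interpret h: group_hom G G \<psi> by unfold_locales (rule hom)
  note reg = regular_G_stable_N_of(1)[OF ab]
  have comm: "\<psi> x \<otimes> \<psi> y = \<psi> y \<otimes> \<psi> x" if "x \<in> carrier G" "y \<in> carrier G" for x y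
    using ab that by (simp add: abelian_endomorphism_def flip: h.hom_mult)
  have cancel: "x \<otimes> (inv x \<otimes> w) = w" "inv x \<otimes> (x \<otimes> w) = w"
    if "x \<in> carrier G" "w \<in> carrier G" for x w
    using that by (simp_all flip: m_assoc)
  (* The factors psi (psi s) and its inverse cancel once psi t is moved out of the way. *)
  have image: "\<psi> (s \<otimes> inv (\<psi> s) \<otimes> t \<otimes> \<psi> s) = \<psi> s \<otimes> \<psi> t"
    if "s \<in> carrier G" "t \<in> carrier G" for s t
    using that comm[of t "\<psi> s"] by (simp add: m_assoc cancel)
  have "bij_betw k (N_of G \<psi>) (carrier G)"
    unfolding k_def
    using bij_betw_trans[OF ev_one_bij_betw[OF reg] fixed_point_free_bij_betw[OF assms(1) hom assms(3)]]
    by (simp add: comp_def)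
  moreover have "k (\<eta> \<otimes>\<^bsub>Perm G\<^esub> \<pi>) = k \<eta> \<otimes> k \<pi>" if "\<eta> \<in> N_of G \<psi>" "\<pi> \<in> N_of G \<psi>" for \<eta> \<pi>
  proof -
    let ?s = "ev_one G \<eta>" and ?t = "ev_one G \<pi>"
    have st: "?s \<in> carrier G" "?t \<in> carrier G" using ev_one_closed[OF reg] that by auto
    have ev: "ev_one G (\<eta> \<otimes>\<^bsub>Perm G\<^esub> \<pi>) = ?s \<otimes> inv (\<psi> ?s) \<otimes> ?t \<otimes> \<psi> ?s"
      using N_of_value[OF ab that(1) st(2)] by (simp add: ev_one_mult[OF reg that])
    show ?thesis
      unfolding k_def ev image[OF st] comm[OF st] using st by (simp add: inv_mult_group m_assoc cancel)
  qed
  ultimately show "k \<in> iso ((Perm G)\<lparr>carrier := N_of G \<psi>\<rparr>) G"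
    by (auto simp: iso_def hom_def dest: bij_betw_apply)
  fix \<sigma> \<eta> assume \<sigma>: "\<sigma> \<in> carrier G" and \<eta>: "\<eta> \<in> N_of G \<psi>"
  let ?s = "ev_one G \<eta>"
  have s: "?s \<in> carrier G" using ev_one_closed[OF reg \<eta>] .
  have ev: "ev_one G (perm_act G \<sigma> \<eta>) = \<sigma> \<otimes> (?s \<otimes> inv (\<psi> ?s) \<otimes> inv \<sigma> \<otimes> \<psi> ?s)"
    using perm_act_left_reg[OF \<sigma>, of \<eta> \<one>] regular_subgroup_Bij[OF reg] \<sigma> \<eta>
      N_of_value[OF ab \<eta> inv_closed[OF \<sigma>]]
    by (simp add: ev_one_def subsetD)
  have "\<psi> (ev_one G (perm_act G \<sigma> \<eta>)) = \<psi> \<sigma> \<otimes> (\<psi> ?s \<otimes> \<psi> (inv \<sigma>))"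
    unfolding ev using \<sigma> s image[of ?s "inv \<sigma>"]
    by (simp only: h.hom_mult m_closed inv_closed h.hom_closed)
  also have "\<dots> = \<psi> ?s"
    using \<sigma> s comm[of ?s "inv \<sigma>"] by (simp add: cancel)
  finally have \<psi>_ev: "\<psi> (ev_one G (perm_act G \<sigma> \<eta>)) = \<psi> ?s" .
  show "k (perm_act G \<sigma> \<eta>) = \<sigma> \<otimes> k \<eta> \<otimes> inv \<sigma>"
    unfolding k_def \<psi>_ev unfolding ev using \<sigma> s by (simp add: m_assoc)
qed

end

section \<open>Transport along a brace equivalence\<close>

theorem corollary5p5:
  fixes G :: "('a, 'b) monoid_scheme"
    and \<psi> :: "'a \<Rightarrow> 'a"
    and N :: "('a \<Rightarrow> 'a) set"
  assumes "group G" and "finite (carrier G)"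
    and "abelian_endomorphism G \<psi>" and "fixed_point_free G \<psi>"
    and "regular_subgroup G N" and "G_stable G N"
    and "brace_equivalent G N (N_of G \<psi>)"
  shows "G_isomorphic G N (left_reg G ` carrier G)"
proof -
  interpret group G by (rule assms(1))
  obtain k where k: "k \<in> iso ((Perm G)\<lparr>carrier := N_of G \<psi>\<rparr>) G"
    and k_act: "\<And>\<sigma> \<eta>. \<lbrakk>\<sigma> \<in> carrier G; \<eta> \<in> N_of G \<psi>\<rbrakk> \<Longrightarrow>
      k (perm_act G \<sigma> \<eta>) = \<sigma> \<otimes>\<^bsub>G\<^esub> k \<eta> \<otimes>\<^bsub>G\<^esub> inv\<^bsub>G\<^esub> \<sigma>"
    using N_of_conj_iso[OF assms(2-4)] by blast
  obtain f \<phi> where f: "f \<in> iso ((Perm G)\<lparr>carrier := N\<rparr>) ((Perm G)\<lparr>carrier := N_of G \<psi>\<rparr>)"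
    and \<phi>: "\<phi> \<in> iso G G"
    and f_act: "\<And>\<sigma> \<eta>. \<lbrakk>\<sigma> \<in> carrier G; \<eta> \<in> N\<rbrakk> \<Longrightarrow> f (perm_act G \<sigma> \<eta>) = perm_act G (\<phi> \<sigma>) (f \<eta>)"
    using brace_equivalent_twisted_iso[OF assms(5,6) regular_G_stable_N_of[OF assms(3)] assms(7)]
    by blast
  define \<phi>' where "\<phi>' = inv_into (carrier G) \<phi>"
  have \<phi>': "\<phi>' \<in> iso G G" unfolding \<phi>'_def using \<phi> by (rule iso_set_sym)
  interpret \<phi>': group_hom G G \<phi>'
    using \<phi>' by unfold_locales (simp add: iso_def)
  show ?thesis
  proof (rule G_isomorphic_left_reg)
    show "\<phi>' \<circ> (k \<circ> f) \<in> iso ((Perm G)\<lparr>carrier := N\<rparr>) G"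
      using iso_set_trans[OF iso_set_trans[OF f k] \<phi>'] .
    fix \<sigma> \<eta> assume \<sigma>: "\<sigma> \<in> carrier G" and \<eta>: "\<eta> \<in> N"
    have f\<eta>: "f \<eta> \<in> N_of G \<psi>" using f \<eta> by (auto simp: iso_def hom_def)
    then have kf\<eta>: "k (f \<eta>) \<in> carrier G" using k by (auto simp: iso_def hom_def)
    have \<phi>\<sigma>: "\<phi> \<sigma> \<in> carrier G" "\<phi>' (\<phi> \<sigma>) = \<sigma>"
      using \<phi> \<sigma> by (auto simp: \<phi>'_def iso_def hom_def bij_betw_def)
    show "(\<phi>' \<circ> (k \<circ> f)) (perm_act G \<sigma> \<eta>) =
        \<sigma> \<otimes>\<^bsub>G\<^esub> (\<phi>' \<circ> (k \<circ> f)) \<eta> \<otimes>\<^bsub>G\<^esub> inv\<^bsub>G\<^esub> \<sigma>"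
      using \<sigma> \<phi>\<sigma> kf\<eta> by (simp add: f_act[OF \<sigma> \<eta>] k_act[OF _ f\<eta>])
  qed
qed

end
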